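(* Let $p\in(0,1)$ and $w_0\in\mathbb{C}\setminus\{0\}$ be fixed. Then the exact region of variability of the second Taylor coefficient $a_2(f)$, $f\in\Sigma^*(p,w_0)$, i.e. the set $\{a_2(f) : f\in\Sigma^*(p,w_0)\}$, is the disc of all $a\in\mathbb{C}$ determined by the inequality $$ \left|a-\left(p+\frac{1}{p}+w_0\right)+\frac{1}{4}w_0\left(p+\frac{1}{p}+\frac{1}{w_0}\right)^2\right|\leq |w_0|\left(1-\frac{1}{4}\left|p+\frac{1}{p}+\frac{1}{w_0}\right|^2\right). $$
   Context: Let $\mathbb{D}=\{z\in\mathbb{C}:|z|<1\}$ and $\overline{\mathbb{C}}=\mathbb{C}\cup\{\infty\}$. For $p\in(0,1)$ and a finite point $w_0\in\mathbb{C}$, $w_0\neq 0$, $\Sigma^*(p,w_0)$ denotes the class of functions $f$ that are meromorphic and univalent (injective) in $\mathbb{D}$, with a simple pole at $z=p$ and no other pole, normalized by $f(0)=0$ and $f'(0)=1$, and such that the complement $\overline{\mathbb{C}}\setminus f(\mathbb{D})$ is a starlike set with respect to $w_0$ (it contains $w_0$ and, with each of its points $w$, the line segment from $w_0$ to $w$). Each $f\in\Sigma^*(p,w_0)$ has a Taylor expansion $f(z)=z+\sum_{n=2}^{\infty}a_n(f)z^n$ for $|z|<p$, which defines $a_2(f)$. *)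

theory Defs
  imports "HOL-Complex_Analysis.Complex_Analysis"
begin

text \<open>
  The extended complex plane is the type \<^typ>\<open>complex option\<close>, with \<^term>\<open>None\<close> as the point at
  infinity (as in the library's \<^const>\<open>Alexandroff_compactification\<close>). A function that is
  \<^const>\<open>nicely_meromorphic_on\<close> a set has the dummy value 0 at its poles; \<open>ext_val\<close> replaces
  that value by infinity.
\<close>

definition ext_val :: "(complex \<Rightarrow> complex) \<Rightarrow> complex \<Rightarrow> complex option" where
  "ext_val f z = (if is_pole f z then None else Some (f z))"

text \<open>
  The centre \<open>w\<^sub>0\<close> is finite. As no segment joins \<open>w\<^sub>0\<close> to infinity, a set that is starlike
  with respect to \<open>w\<^sub>0\<close> consists of finite points. For the complements considered below
  this is automatic, since infinity is the value taken at the pole.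
\<close>

definition starlike_wrt :: "complex \<Rightarrow> complex option set \<Rightarrow> bool" where
  "starlike_wrt w\<^sub>0 E \<longleftrightarrow>
     Some w\<^sub>0 \<in> E \<and> (\<forall>x\<in>E. \<exists>w. x = Some w \<and> Some ` closed_segment w\<^sub>0 w \<subseteq> E)"

definition Sigma_star :: "real \<Rightarrow> complex \<Rightarrow> (complex \<Rightarrow> complex) set" where
  "Sigma_star p w\<^sub>0 = {f.
     f nicely_meromorphic_on ball 0 1 \<and>
     inj_on (ext_val f) (ball 0 1) \<and>
     {z \<in> ball 0 1. is_pole f z} = {complex_of_real p} \<and>
     zorder f (complex_of_real p) = -1 \<and>
     f 0 = 0 \<and> deriv f 0 = 1 \<and>
     starlike_wrt w\<^sub>0 (- (ext_val f ` ball 0 1))}"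

definition taylor_coeff :: "nat \<Rightarrow> (complex \<Rightarrow> complex) \<Rightarrow> complex" where
  "taylor_coeff n f = fps_nth (fps_expansion f 0) n"

end

theory Submission
  imports Defs
begin

text \<open>
  For \<open>f \<in> \<Sigma>\<^sup>*(p, w)\<close> the function \<open>h = 1 / (f - w)\<close> is univalent on the disc, vanishes at \<open>p\<close> and has
  an image that is starlike with respect to \<open>0\<close>. Composing with a disc automorphism \<open>T\<close> that sends
  \<open>p\<close> to \<open>0\<close>, \<open>h = k \<circ> T\<close> for a classical starlike function \<open>k\<close>, that is,
  \<open>\<zeta> k'(\<zeta>) / k(\<zeta>) = (1 + \<zeta> \<phi>) / (1 - \<zeta> \<phi>)\<close>
  with \<open>|\<phi>| \<le> 1\<close>. In terms of \<open>\<psi> = (\<phi> \<circ> T + p) / (1 + p (\<phi> \<circ> T))\<close>, again bounded by 1, this becomes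
  \<open>h'(z) / h(z) = 2 \<psi> / (1 - z \<psi>) + 1 / (z - p) - p / (1 - p z)\<close>. The normalization of \<open>f\<close> fixes
  \<open>\<psi>(0) = (p + 1/p + 1/w) / 2\<close>, and \<open>a\<^sub>2\<close> is an affine function of \<open>\<psi>'(0)\<close> with slope \<open>w\<close>. Hence the
  region of variability is the image of the Schwarz--Pick disc \<open>|\<psi>'(0)| \<le> 1 - |\<psi>(0)|\<^sup>2\<close>.
\<close>

section \<open>Schwarz and Schwarz-Pick estimates for functions bounded by 1\<close>

text \<open>\<open>Schwarz_Lemma\<close> asks for values in the open disc, so it is applied to
  \<open>r * f\<close> with \<open>r < 1\<close>, and then \<open>r\<close> tends to 1.\<close>

lemma Schwarz_Lemma_closed:
  assumes f: "f holomorphic_on ball 0 1" and "f 0 = 0"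
    and le: "\<And>z. norm z < 1 \<Longrightarrow> norm (f z) \<le> 1" and z: "norm z < 1"
  shows "norm (f z) \<le> norm z"
proof (rule field_le_mult_one_interval)
  fix r :: real assume r: "0 < r" "r < 1"
  have "norm (of_real r * f z) \<le> norm z"
  proof (rule Schwarz_Lemma(1)[where f = "\<lambda>z. of_real r * f z"])
    show "(\<lambda>z. of_real r * f z) holomorphic_on ball 0 1"
      by (intro holomorphic_intros f)
    show "norm (of_real r * f w) < 1" if "norm w < 1" for w
      using mult_left_mono[OF le[OF that] less_imp_le[OF r(1)]] r by (simp only: norm_mult norm_of_real)
  qed (use assms in auto)
  then show "r * norm (f z) \<le> norm z" using r by (simp add: norm_mult)
qed

text \<open>After scaling by \<open>r < 1\<close>, a Moebius map that carries \<open>r * f 0\<close>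
  to 0 makes the Schwarz lemma applicable. Its derivative bound at 0 is the claim for
  \<open>r * f\<close>, and \<open>r\<close> tends to 1.\<close>

lemma Schwarz_Pick_at_0:
  assumes f: "f holomorphic_on ball 0 1"
    and le: "\<And>z. norm z < 1 \<Longrightarrow> norm (f z) \<le> 1"
  shows "norm (deriv f 0) \<le> 1 - (norm (f 0))\<^sup>2"
proof -
  have strict: "r * norm (deriv f 0) \<le> 1 - r\<^sup>2 * (norm (f 0))\<^sup>2" if r: "0 < r" "r < 1" for r :: real
  proof -
    define w where "w = of_real r * f 0"
    define g where "g = (\<lambda>z. Moebius_function 0 w (of_real r * f z))"
    have lt: "norm (of_real r * f z) < 1" if "norm z < 1" for z
      using mult_left_mono[OF le[OF that] less_imp_le[OF r(1)]] r by (simp only: norm_mult norm_of_real)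
    have w: "norm w < 1" unfolding w_def using lt[of 0] by simp
    have hol: "(\<lambda>z. of_real r * f z) holomorphic_on ball 0 1"
      by (intro holomorphic_intros f)
    have "g holomorphic_on ball 0 1"
      unfolding g_def
      by (rule holomorphic_on_compose_gen[OF hol Moebius_function_holomorphic[OF w], unfolded o_def])
         (use lt in auto)
    moreover have "g 0 = 0" by (simp add: g_def w_def Moebius_function_eq_zero)
    moreover have "norm (g z) < 1" if "norm z < 1" for z
      unfolding g_def by (rule Moebius_function_norm_lt_1[OF w lt[OF that]])
    ultimately have g': "norm (deriv g 0) \<le> 1"
      by (rule Schwarz_Lemma(2)[of g 0]) auto
    have w2: "(norm w)\<^sup>2 < 1" using w by (simp add: abs_square_less_1)
    have ww: "1 - cnj w * w = of_real (1 - (norm w)\<^sup>2)"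
      by (simp only: of_real_diff complex_norm_square) simp
    then have ne: "1 - cnj w * w \<noteq> 0"
      using w2 by (simp only: of_real_eq_0_iff)
    have "(f has_field_derivative deriv f 0) (at 0)"
      using f holomorphic_derivI[of f "ball 0 1" 0] by simp
    then have f': "((\<lambda>z. of_real r * f z) has_field_derivative of_real r * deriv f 0) (at 0)"
      by (rule DERIV_cmult)
    have "(g has_field_derivative (of_real r * deriv f 0 / (1 - cnj w * w))) (at 0)"
      unfolding g_def Moebius_function_simple
    proof (rule DERIV_cong[OF DERIV_divide])
      show "((\<lambda>z. of_real r * f z - w) has_field_derivative of_real r * deriv f 0) (at 0)"
        using DERIV_diff[OF f' DERIV_const[of w]] by simp
      show "((\<lambda>z. 1 - cnj w * (of_real r * f z)) has_field_derivative - (cnj w * (of_real r * deriv f 0))) (at 0)"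
        using DERIV_diff[OF DERIV_const[of 1] DERIV_cmult[OF f', of "cnj w"]] by simp
    qed (use ne in \<open>auto simp: w_def\<close>)
    then have "deriv g 0 = of_real r * deriv f 0 / of_real (1 - (norm w)\<^sup>2)"
      unfolding ww by (rule DERIV_imp_deriv)
    then have "norm (deriv g 0) = r * norm (deriv f 0) / (1 - (norm w)\<^sup>2)"
      using r w2 by (simp only: norm_divide norm_mult norm_of_real) simp
    then have "r * norm (deriv f 0) \<le> 1 - (norm w)\<^sup>2"
      using w2 mult_right_mono[OF g', of "1 - (norm w)\<^sup>2"] by simp
    then show ?thesis using r by (simp add: w_def norm_mult power_mult_distrib)
  qed
  have "norm (deriv f 0) + (norm (f 0))\<^sup>2 \<le> 1"
  proof (rule field_le_mult_one_interval)
    \<comment> \<open>The scaling factor \<open>sqrt s\<close> turns the square in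
      \<open>strict\<close> into \<open>s\<close> itself, and \<open>s \<le> sqrt s\<close> handles
      the derivative term.\<close>
    fix s :: real assume s: "0 < s" "s < 1"
    then have "s * s \<le> s" using mult_left_mono[of s 1 s] by simp
    then have "s * s * norm (deriv f 0) \<le> s * norm (deriv f 0)" by (intro mult_right_mono) auto
    then show "s * (norm (deriv f 0) + (norm (f 0))\<^sup>2) \<le> 1"
      using strict[of "sqrt s"] s real_le_rsqrt[of s s] mult_right_mono[of s "sqrt s" "norm (deriv f 0)"]
        by (simp add: algebra_simps power2_eq_square)
  qed
  then show ?thesis by simp
qed

section \<open>Analytic characterization of starlike univalent functions\<close>

lemma Re_of_real_mult: "Re (of_real x * z) = x * Re z"
  by simp

text \<open>This is the real derivative of a squared modulus along a ray from the origin. Its sign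
  tells whether the preimage under a starlike function moves outwards.\<close>

lemma ray_norm_square_has_derivative:
  assumes "(g has_field_derivative d) (at (of_real t * v))"
  shows "((\<lambda>s. (cmod (g (of_real s * v)))\<^sup>2) has_real_derivative
           2 * Re (cnj (g (of_real t * v)) * (v * d))) (at t)"
proof -
  have "((\<lambda>s. of_real s * v) has_vector_derivative v) (at t)"
    by (auto intro!: derivative_eq_intros)
  then have gd: "((\<lambda>s. g (of_real s * v)) has_vector_derivative v * d) (at t)"
    using field_vector_diff_chain_at[of "\<lambda>s. of_real s * v" v t g d] assms by (simp add: o_def)
  have Re: "((\<lambda>s. Re (g (of_real s * v))) has_real_derivative Re (v * d)) (at t)"
   and Im: "((\<lambda>s. Im (g (of_real s * v))) has_real_derivative Im (v * d)) (at t)"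
    unfolding has_real_derivative_iff_has_vector_derivative
    using bounded_linear.has_vector_derivative[OF bounded_linear_Re gd]
          bounded_linear.has_vector_derivative[OF bounded_linear_Im gd] by blast+
  show ?thesis
    unfolding cmod_power2
    by (rule DERIV_cong[OF DERIV_add[OF DERIV_power[OF Re] DERIV_power[OF Im]]]) (simp add: algebra_simps)
qed

text \<open>
  The Schwarz lemma applied to \<open>\<zeta> \<mapsto> k\<^sup>-\<^sup>1(s k(\<zeta>))\<close> shows that \<open>|k\<^sup>-\<^sup>1(s k(\<zeta>))|\<^sup>2\<close> is at most its value at \<open>s = 1\<close>;
  the sign of its derivative there is the claim.
\<close>

lemma starlike_imp_Re_nonneg:
  assumes k: "k holomorphic_on ball 0 1" "inj_on k (ball 0 1)" "k 0 = 0"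
    and star: "\<And>v t. \<lbrakk>v \<in> k ` ball 0 1; 0 \<le> t; t \<le> 1\<rbrakk> \<Longrightarrow> of_real t * v \<in> k ` ball 0 1"
    and z: "norm z < 1"
  shows "0 \<le> Re (z * deriv k z / k z)"
proof -
  obtain g where g: "g holomorphic_on k ` ball 0 1"
      "\<And>z. z \<in> ball 0 1 \<Longrightarrow> deriv k z * deriv g (k z) = 1"
      "\<And>z. z \<in> ball 0 1 \<Longrightarrow> g (k z) = z"
    using holomorphic_has_inverse[OF k(1) open_ball k(2)] by metis
  have op: "open (k ` ball 0 1)" by (rule open_mapping_thm3[OF k(1) open_ball k(2)])
  define F where "F = (\<lambda>s. (cmod (g (of_real s * k z)))\<^sup>2)"
  have F1: "F s \<le> F 1" if "0 \<le> s" "s \<le> 1" for s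
  proof -
    have "cmod (g (of_real s * k z)) \<le> cmod z"
    proof (rule Schwarz_Lemma_closed[of "\<lambda>z. g (of_real s * k z)"])
      show "(\<lambda>z. g (of_real s * k z)) holomorphic_on ball 0 1"
        by (rule holomorphic_on_compose_gen[of "\<lambda>z. of_real s * k z" _ g, unfolded o_def])
           (use star that in \<open>auto intro!: holomorphic_intros k g(1)\<close>)
      show "g (of_real s * k 0) = 0" using g(3)[of 0] k(3) by simp
      show "cmod (g (of_real s * k w)) \<le> 1" if w: "cmod w < 1" for w
      proof -
        have "of_real s * k w \<in> k ` ball 0 1" using star \<open>0 \<le> s\<close> \<open>s \<le> 1\<close> w by simp
        then show ?thesis using g(3) by auto
      qed
    qed (fact z)
    moreover have "g (k z) = z" using g(3) z by simp
    ultimately show ?thesis unfolding F_def by (simp add: power_mono)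
  qed
  have "(g has_field_derivative deriv g (k z)) (at (of_real 1 * k z))"
    using holomorphic_derivI[OF g(1) op] z by simp
  from ray_norm_square_has_derivative[OF this]
  have D: "(F has_real_derivative 2 * Re (cnj z * (k z * deriv g (k z)))) (at 1)"
    using g(3)[of z] z by (simp add: F_def)
  have "0 \<le> 2 * Re (cnj z * (k z * deriv g (k z)))"
  proof (rule ccontr)
    assume "\<not> ?thesis"
    with DERIV_neg_dec_left[OF D] obtain d where d: "0 < d" "\<And>h. 0 < h \<Longrightarrow> h < d \<Longrightarrow> F 1 < F (1 - h)"
      by auto
    \<comment> \<open>The cap at 1 keeps \<open>1 - h\<close> in the unit interval, where
      \<open>F1\<close> applies.\<close>
    define h where "h = min (d/2) 1"
    have "0 < h" "h < d" "h \<le> 1" using d(1) by (auto simp: h_def)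
    then show False using d(2)[of h] F1[of "1 - h"] by simp
  qed
  moreover have "deriv g (k z) = 1 / deriv k z" "deriv k z \<noteq> 0"
    using g(2)[of z] z by (auto simp: divide_simps mult.commute)
  ultimately have *: "0 \<le> Re (cnj z * (k z / deriv k z))" by simp
  show ?thesis
  \<comment> \<open>Taking inverses preserves the sign of the real part. In the excluded case the
    quotient is 0, by the convention for division by 0 or because \<open>z\<close> vanishes.\<close>
  proof (cases "z = 0 \<or> k z = 0")
    case False
    then have "z * deriv k z / k z = z * cnj z * inverse (cnj z * (k z / deriv k z))"
      by simp
    also have "\<dots> = of_real ((cmod z)\<^sup>2) * inverse (cnj z * (k z / deriv k z))"
      by (simp only: complex_norm_square)
    finally have "Re (z * deriv k z / k z) = (cmod z)\<^sup>2 * Re (inverse (cnj z * (k z / deriv k z)))"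
      by (simp only: Re_of_real_mult)
    moreover have "0 \<le> Re (inverse (cnj z * (k z / deriv k z)))"
      unfolding inverse_complex.sel using * by (intro divide_nonneg_nonneg) auto
    ultimately show ?thesis by simp
  qed auto
qed

text \<open>Noshiro-Warschawski criterion: on the segment from \<open>a\<close> to
  \<open>b = a + d\<close>, the real part of \<open>cnj d * G\<close> has derivative
  \<open>(cmod d)\<^sup>2 * Re G'\<close> and so increases strictly.\<close>

lemma Re_deriv_pos_imp_inj_on:
  assumes "convex S" and G: "\<And>u. u \<in> S \<Longrightarrow> (G has_field_derivative G' u) (at u)"
    and pos: "\<And>u. u \<in> S \<Longrightarrow> 0 < Re (G' u)"
  shows "inj_on G S"
proof (rule inj_onI, rule ccontr)
  fix a b assume a: "a \<in> S" and b: "b \<in> S" and eq: "G a = G b" and ne: "a \<noteq> b"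
  define d where "d = b - a"
  have "Re (cnj d * G (a + of_real 0 * d)) < Re (cnj d * G (a + of_real 1 * d))"
  proof (rule DERIV_pos_imp_increasing[of "0::real" 1])
    fix s :: real assume s: "0 \<le> s" "s \<le> 1"
    have "a + of_real s * d = (1 - s) *\<^sub>R a + s *\<^sub>R b"
      by (simp add: d_def scaleR_conv_of_real algebra_simps)
    then have in_S: "a + of_real s * d \<in> S"
      using \<open>convex S\<close> a b s by (simp add: convex_alt)
    have "((\<lambda>s. a + of_real s * d) has_vector_derivative d) (at s)"
      by (auto intro!: derivative_eq_intros)
    then have "((\<lambda>s. G (a + of_real s * d)) has_vector_derivative d * G' (a + of_real s * d)) (at s)"
      using field_vector_diff_chain_at[of "\<lambda>s. a + of_real s * d" d s G] G[OF in_S] by (simp add: o_def)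
    then have "((\<lambda>s. cnj d * G (a + of_real s * d)) has_vector_derivative cnj d * (d * G' (a + of_real s * d))) (at s)"
      by (rule has_vector_derivative_mult_right)
    then have "((\<lambda>s. Re (cnj d * G (a + of_real s * d))) has_real_derivative
        Re (cnj d * (d * G' (a + of_real s * d)))) (at s)"
      unfolding has_real_derivative_iff_has_vector_derivative
      by (rule bounded_linear.has_vector_derivative[OF bounded_linear_Re])
    moreover have "cnj d * (d * G' (a + of_real s * d)) = of_real ((cmod d)\<^sup>2) * G' (a + of_real s * d)"
      by (simp only: complex_norm_square) simp
    moreover have "0 < (cmod d)\<^sup>2 * Re (G' (a + of_real s * d))"
      using pos[OF in_S] ne by (simp add: d_def)
    ultimately show "\<exists>y. ((\<lambda>s. Re (cnj d * G (a + of_real s * d))) has_real_derivative y) (at s) \<and> 0 < y"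
      by (auto simp del: of_real_power)
  qed simp
  then show False using eq by (simp add: d_def)
qed

text \<open>
  Injectivity: in the logarithmic coordinate \<open>\<zeta> = e\<^sup>u\<close>, \<open>log k\<close> has a derivative with positive real part on
  the convex left half-plane. Starlikeness: \<open>|k\<^sup>-\<^sup>1(s v)|\<close> increases with \<open>s\<close>, so a ray cannot re-enter the image of a
  smaller disc once it has left it.
\<close>

lemma starlike_criterion:
  assumes M: "M holomorphic_on ball 0 1"
    and pos: "\<And>z. norm z < 1 \<Longrightarrow> 0 < Re (1 + z * deriv M z)"
  defines "k \<equiv> \<lambda>z. z * exp (M z)"
  shows "inj_on k (ball 0 1)"
    and "\<And>v t. \<lbrakk>v \<in> k ` ball 0 1; 0 \<le> t; t \<le> 1\<rbrakk> \<Longrightarrow> of_real t * v \<in> k ` ball 0 1"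
proof -
  have dM: "(M has_field_derivative deriv M z) (at z)" if "norm z < 1" for z
    using holomorphic_derivI[OF M open_ball] that by simp
  define G where "G = (\<lambda>u. u + M (exp u))"
  have inj_G: "inj_on G {u. Re u < 0}"
  proof (rule Re_deriv_pos_imp_inj_on)
    show "convex {u. Re u < 0}" by (rule convex_halfspace_Re_lt)
    fix u assume "u \<in> {u. Re u < 0}"
    then have u: "norm (exp u) < 1" by simp
    show "(G has_field_derivative 1 + exp u * deriv M (exp u)) (at u)"
      unfolding G_def using DERIV_add[OF DERIV_ident DERIV_chain2[OF dM[OF u] DERIV_exp]]
      by (simp add: mult.commute)
    show "0 < Re (1 + exp u * deriv M (exp u))" by (rule pos[OF u])
  qed
  show inj: "inj_on k (ball 0 1)"
  proof (rule inj_onI)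
    fix a b assume ab: "a \<in> ball 0 1" "b \<in> ball 0 1" and eq: "k a = k b"
    show "a = b"
    proof (cases "k a = 0")
      case True
      then show ?thesis using eq by (simp add: k_def)
    next
      case False
      then have ne: "a \<noteq> 0" "b \<noteq> 0" using eq by (auto simp: k_def)
      have "exp (G (Ln a)) = exp (G (Ln b))"
        using eq ne by (simp add: G_def k_def exp_add)
      then obtain n :: int where n: "G (Ln a) = G (Ln b) + (of_int (2 * n) * pi) * \<i>"
        by (auto simp: exp_eq)
      \<comment> \<open>The logarithms of equal values may differ by a period. Since
        \<open>G (u + c) = G u + c\<close> and \<open>c\<close> is purely imaginary,
        \<open>Ln b\<close> can be shifted by \<open>c\<close> inside the half-plane to absorb
        it.\<close>
      define c where "c = (of_int (2 * n) * pi) * \<i>"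
      have c: "exp c = 1" unfolding c_def by (subst exp_eq_1) auto
      have "G (Ln b + c) = G (Ln b) + c" by (simp add: G_def exp_add c)
      then have "G (Ln a) = G (Ln b + c)" using n by (simp add: c_def)
      moreover have "Re (Ln a) < 0" "Re (Ln b + c) < 0"
        using ab ne by (auto simp: c_def)
      ultimately have "Ln a = Ln b + c" using inj_G by (auto dest: inj_onD)
      then have "exp (Ln a) = exp (Ln b) * exp c" by (metis exp_add)
      then show ?thesis using c ne by simp
    qed
  qed
  have k: "k holomorphic_on ball 0 1" unfolding k_def by (intro holomorphic_intros M)
  have dk: "deriv k z = exp (M z) * (1 + z * deriv M z)" if "norm z < 1" for z
  proof (rule DERIV_imp_deriv)
    show "(k has_field_derivative exp (M z) * (1 + z * deriv M z)) (at z)"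
      unfolding k_def
      by (rule DERIV_cong[OF DERIV_mult[OF DERIV_ident DERIV_chain2[OF DERIV_exp dM[OF that]]]])
         (simp add: algebra_simps)
  qed
  obtain g where g: "g holomorphic_on k ` ball 0 1"
      "\<And>z. z \<in> ball 0 1 \<Longrightarrow> deriv k z * deriv g (k z) = 1"
      "\<And>z. z \<in> ball 0 1 \<Longrightarrow> g (k z) = z"
    using holomorphic_has_inverse[OF k open_ball inj] by metis
  have op: "open (k ` ball 0 1)" by (rule open_mapping_thm3[OF k open_ball inj])
  fix v t assume v: "v \<in> k ` ball 0 1" and t: "0 \<le> t" "t \<le> (1::real)"
  then obtain z where z: "norm z < 1" "v = k z" by auto
  \<comment> \<open>The intermediate radius gives an open image of \<open>ball 0 r\<close> and a
    compact image of \<open>cball 0 r\<close>, both inside the image of the unit disc.\<close>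
  obtain r where r: "norm z < r" "r < 1" using dense[OF z(1)] by blast
  then have r0: "0 < r" using norm_ge_zero[of z] by linarith
  have sub: "ball 0 r \<subseteq> ball (0::complex) 1" "cball 0 r \<subseteq> ball (0::complex) 1" using r by auto
  have opr: "open (k ` ball 0 r)"
    by (rule open_mapping_thm3[OF holomorphic_on_subset[OF k] open_ball inj_on_subset[OF inj]]) (use sub in auto)
  \<comment> \<open>The parameters at which the segment from 0 to \<open>v\<close> is outside the
    image of the smaller disc. If there are any, the largest one, \<open>s\<close>, is where the ray
    enters that image for the last time.\<close>
  define X where "X = {0..1} \<inter> (\<lambda>s. of_real s * v) -` (- (k ` ball 0 r))"
  have "X = {}"
  proof (rule ccontr)
    assume "X \<noteq> {}"
    have "compact X" unfolding X_def
      by (intro compact_Int_closed compact_Icc continuous_closed_vimage) (use opr in \<open>auto intro!: continuous_intros\<close>)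
    then obtain s where s: "s \<in> X" and max: "\<And>s'. s' \<in> X \<Longrightarrow> s' \<le> s"
      using compact_attains_sup[of X] \<open>X \<noteq> {}\<close> by blast
    have "v \<in> k ` ball 0 r" using r z by auto
    moreover have "0 \<in> k ` ball 0 r" using r0 by (auto simp: k_def image_iff intro!: bexI[of _ 0])
    ultimately have s01: "0 < s" "s < 1" using s by (auto simp: X_def less_le)
    have inside: "of_real s' * v \<in> k ` ball 0 r" if "s < s'" "s' \<le> 1" for s'
      using max[of s'] that s01 by (force simp: X_def)
    \<comment> \<open>The point is a limit from the right of points in the image of the smaller
      disc. As \<open>s\<close> is in \<open>X\<close>, its preimage \<open>\<zeta>\<close> then has
      modulus exactly \<open>r\<close>.\<close>
    have "of_real s * v \<in> k ` cball 0 r"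
    proof -
      have cl: "closed (k ` cball 0 r)"
        by (intro compact_imp_closed compact_continuous_image compact_cball
            holomorphic_on_imp_continuous_on holomorphic_on_subset[OF k] sub)
      have lim: "((\<lambda>s'. of_real s' * v) \<longlongrightarrow> of_real s * v) (at_right s)"
        by (intro tendsto_intros)
      have ev: "\<forall>\<^sub>F s' in at_right s. of_real s' * v \<in> k ` cball 0 r"
        by (intro eventually_at_rightI[of s 1]) (use inside s01 in \<open>force+\<close>)
      show ?thesis
        by (rule Lim_in_closed_set[OF cl ev _ lim]) simp
    qed
    then obtain \<zeta> where \<zeta>: "norm \<zeta> \<le> r" "of_real s * v = k \<zeta>" by auto
    moreover have "\<not> norm \<zeta> < r" using s \<zeta> by (auto simp: X_def)
    ultimately have nr: "norm \<zeta> = r" by simp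
    have \<zeta>1: "norm \<zeta> < 1" using nr r by simp
    have g\<zeta>: "g (of_real s * v) = \<zeta>" using g(3) \<zeta>1 \<zeta>(2) by simp
    define d where "d = deriv g (k \<zeta>)"
    have "(g has_field_derivative d) (at (of_real s * v))"
      unfolding d_def \<zeta>(2) using holomorphic_derivI[OF g(1) op] \<zeta>1 by simp
    from ray_norm_square_has_derivative[OF this]
    have D: "((\<lambda>s. (cmod (g (of_real s * v)))\<^sup>2) has_real_derivative 2 * Re (cnj \<zeta> * (v * d))) (at s)"
      by (simp only: g\<zeta>)
    define q where "q = 1 + \<zeta> * deriv M \<zeta>"
    have q: "0 < Re q" unfolding q_def by (rule pos[OF \<zeta>1])
    have "exp (M \<zeta>) * q * d = 1"
      using g(2)[of \<zeta>] \<zeta>1 dk[OF \<zeta>1] by (simp add: d_def q_def)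
    then have d: "d = inverse (exp (M \<zeta>) * q)"
      by (metis inverse_unique)
    have "v = \<zeta> * exp (M \<zeta>) / of_real s"
      using \<zeta>(2) s01 by (simp add: k_def field_simps)
    then have "cnj \<zeta> * (v * d) = \<zeta> * cnj \<zeta> / of_real s * inverse q"
      by (simp add: d)
    also have "\<dots> = of_real (r\<^sup>2 / s) * inverse q"
      using nr by (simp add: complex_norm_square[symmetric])
    finally have "2 * Re (cnj \<zeta> * (v * d)) = 2 * (r\<^sup>2 / s * Re (inverse q))"
      by (simp only: Re_of_real_mult)
    moreover have "0 < 2 * (r\<^sup>2 / s * Re (inverse q))"
      unfolding inverse_complex.sel using q s01 r0
      by (intro mult_pos_pos divide_pos_pos add_pos_nonneg) auto
    ultimately have "0 < 2 * Re (cnj \<zeta> * (v * d))" by (simp only:)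
    \<comment> \<open>The positive derivative makes the preimage exceed modulus \<open>r\<close>
      just after \<open>s\<close>, although \<open>inside\<close> puts it in \<open>ball 0 r\<close>
      there.\<close>
    from DERIV_pos_inc_right[OF D this] obtain e
      where e: "0 < e" "\<And>h. 0 < h \<Longrightarrow> h < e \<Longrightarrow> (cmod \<zeta>)\<^sup>2 < (cmod (g (of_real (s + h) * v)))\<^sup>2"
      by (auto simp: g\<zeta>)
    define h where "h = min (e/2) (1 - s)"
    have h: "0 < h" "h < e" "s + h \<le> 1" using e(1) s01 by (auto simp: h_def)
    obtain y where y: "norm y < r" "of_real (s + h) * v = k y" using inside[of "s + h"] h by auto
    have "g (of_real (s + h) * v) = y" unfolding y(2) using g(3) y(1) r by simp
    then have "r < norm y"
      using e(2)[OF h(1,2)] nr by (simp only:) (auto intro: power2_less_imp_less)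
    then show False using y(1) by simp
  qed
  then have "of_real t * v \<in> k ` ball 0 r"
    using t unfolding X_def disjoint_iff by (metis ComplI atLeastAtMost_iff vimageI2)
  then show "of_real t * v \<in> k ` ball 0 1"
    using sub(1) by blast
qed

section \<open>The second Taylor coefficient in terms of the differential equation\<close>

text \<open>The coefficient is half the second derivative at 0, found by differentiating the right
  side of the equation once and using \<open>f 0 = 0\<close>.\<close>

lemma taylor_coeff_2_of_log_deriv:
  assumes f: "f holomorphic_on ball 0 e" "0 < e" "f 0 = 0"
    and ode: "\<And>z. norm z < e \<Longrightarrow> deriv f z = (w - f z) * L z"
    and L: "(L has_field_derivative L') (at 0)"
  shows "taylor_coeff 2 f = (w * L' - deriv f 0 * L 0) / 2"
proof -
  have "(f has_field_derivative deriv f 0) (at 0)"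
    using holomorphic_derivI[OF f(1) open_ball] f(2) by simp
  then have D: "((\<lambda>z. (w - f z) * L z) has_field_derivative w * L' - deriv f 0 * L 0) (at 0)"
    by (rule DERIV_cong[OF DERIV_mult[OF DERIV_diff[OF DERIV_const] L]]) (simp add: f(3))
  have "\<forall>\<^sub>F z in nhds 0. deriv f z = (w - f z) * L z"
    using ode f(2) by (auto simp: eventually_nhds_metric dist_norm)
  then have "deriv (deriv f) 0 = deriv (\<lambda>z. (w - f z) * L z) 0"
    by (rule deriv_cong_ev) simp
  also have "\<dots> = w * L' - deriv f 0 * L 0" by (rule DERIV_imp_deriv[OF D])
  finally show ?thesis
    by (simp add: taylor_coeff_def fps_expansion_def numeral_2_eq_2)
qed

text \<open>The equation at 0 expresses \<open>deriv f 0\<close> through \<open>\<psi> 0\<close>.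
  Once this derivative is 1, \<open>\<psi> 0\<close> is determined by \<open>p\<close> and
  \<open>w\<close>, and \<open>deriv \<psi> 0\<close> is the only free quantity left in the
  coefficient.\<close>

lemma taylor_coeff_2_parametrized:
  fixes p w :: complex
  assumes f: "f holomorphic_on ball 0 e" "0 < e" "f 0 = 0"
    and ode: "\<And>z. norm z < e \<Longrightarrow> deriv f z =
      (w - f z) * (2 * \<psi> z / (1 - z * \<psi> z) + 1 / (z - p) - p / (1 - p * z))"
    and \<psi>: "\<psi> holomorphic_on ball 0 e" and p: "p \<noteq> 0"
  shows "deriv f 0 = w * (2 * \<psi> 0 - (p + 1 / p))"
    and "deriv f 0 = 1 \<Longrightarrow>
      taylor_coeff 2 f - (p + 1 / p + w) + 1 / 4 * w * (p + 1 / p + 1 / w)\<^sup>2 = w * deriv \<psi> 0"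
proof -
  have *: "deriv f 0 = w * (2 * \<psi> 0 - 1 / p - p)"
    using ode[of 0] f by simp
  then show "deriv f 0 = w * (2 * \<psi> 0 - (p + 1 / p))" by (simp add: algebra_simps)
  have \<psi>': "(\<psi> has_field_derivative deriv \<psi> 0) (at 0)"
    using holomorphic_derivI[OF \<psi> open_ball] f(2) by simp
  have "((\<lambda>z. 2 * \<psi> z / (1 - z * \<psi> z) + 1 / (z - p) - p / (1 - p * z)) has_field_derivative
      2 * deriv \<psi> 0 + 2 * (\<psi> 0)\<^sup>2 - 1 / p\<^sup>2 - p\<^sup>2) (at 0)"
    using p by (auto intro!: derivative_eq_intros \<psi>' simp: power2_eq_square)
  from taylor_coeff_2_of_log_deriv[OF f ode this]
  have a2: "taylor_coeff 2 f = (w * (2 * deriv \<psi> 0 + 2 * (\<psi> 0)\<^sup>2 - 1 / p\<^sup>2 - p\<^sup>2)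
     - deriv f 0 * (2 * \<psi> 0 - 1 / p - p)) / 2"
    by simp
  assume 1: "deriv f 0 = 1"
  \<comment> \<open>Names for the reciprocals turn the claim into a polynomial identity modulo
    \<open>p * r = 1\<close> and \<open>w * v = 1\<close>. The factor 4 below clears the numerical
    denominators.\<close>
  define r where "r = 1 / p"
  define v where "v = 1 / w"
  have pr: "p * r = 1" using p by (simp add: r_def)
  have "w \<noteq> 0" using 1 * by auto
  then have wv: "w * v = 1" by (simp add: v_def)
  have "v = 2 * \<psi> 0 - r - p" using * 1 \<open>w \<noteq> 0\<close> by (simp add: v_def r_def field_simps)
  then have v: "2 * \<psi> 0 - 1 / p - p = v" and psi: "\<psi> 0 = (v + r + p) / 2" by (simp_all add: r_def)
  have "taylor_coeff 2 f = (w * (2 * deriv \<psi> 0 + 2 * (\<psi> 0)\<^sup>2 - r\<^sup>2 - p\<^sup>2) - v) / 2"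
    using a2 unfolding 1 v r_def by (simp add: power_one_over)
  then have "4 * (taylor_coeff 2 f - (p + r + w) + 1 / 4 * w * (p + r + v)\<^sup>2 - w * deriv \<psi> 0) = 0"
    unfolding psi using wv pr by (simp add: field_simps power2_eq_square) algebra
  then show "taylor_coeff 2 f - (p + 1 / p + w) + 1 / 4 * w * (p + 1 / p + 1 / w)\<^sup>2 = w * deriv \<psi> 0"
    unfolding r_def[symmetric] v_def[symmetric] by (metis eq_iff_diff_eq_0 mult_eq_0_iff zero_neq_numeral)
qed

section \<open>Change of variable by a disc automorphism\<close>

text \<open>The squared moduli of denominator and numerator differ by
  \<open>(1 - p\<^sup>2) * (1 - (cmod a)\<^sup>2)\<close>. The point \<open>a\<close> may lie on the
  unit circle, and both signs of \<open>p\<close> occur later, for the map and its inverse.\<close>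

lemma norm_disc_automorphism_le_1:
  fixes a :: complex and p :: real
  assumes "norm a \<le> 1" "\<bar>p\<bar> < 1"
  shows "1 + of_real p * a \<noteq> 0" "norm ((a + of_real p) / (1 + of_real p * a)) \<le> 1"
proof -
  have "norm (of_real p * a) < 1"
    using mult_left_mono[OF assms(1), of "\<bar>p\<bar>"] assms(2) by (simp add: norm_mult)
  then show ne: "1 + of_real p * a \<noteq> 0"
    by (metis add_eq_0_iff less_irrefl norm_minus_cancel norm_one)
  have "(cmod (1 + of_real p * a))\<^sup>2 - (cmod (a + of_real p))\<^sup>2 = (1 - p\<^sup>2) * (1 - (cmod a)\<^sup>2)"
    unfolding cmod_power2 by (simp add: power2_eq_square algebra_simps)
  moreover have "0 \<le> (1 - p\<^sup>2) * (1 - (cmod a)\<^sup>2)"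
    using assms by (intro mult_nonneg_nonneg) (auto simp: abs_square_le_1)
  ultimately have "(cmod (a + of_real p))\<^sup>2 \<le> (cmod (1 + of_real p * a))\<^sup>2"
    by linarith
  then have "cmod (a + of_real p) \<le> cmod (1 + of_real p * a)"
    by (rule power2_le_imp_le) simp
  then show "norm ((a + of_real p) / (1 + of_real p * a)) \<le> 1"
    using ne by (simp add: norm_divide)
qed

text \<open>The logarithmic derivative of \<open>T * m(T)\<close> is
  \<open>T' * (1 / T + m' / m(T))\<close>. The substitution for \<open>\<psi>\<close> is chosen so
  that \<open>1 - T z * \<phi>\<close> becomes \<open>1 - z * \<psi>\<close> up to the factor
  \<open>(1 - p * z) / (1 + p * \<phi>)\<close>.\<close>

lemma moebius_pullback_log_deriv:
  fixes p c z m' :: complex and m :: "complex \<Rightarrow> complex"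
  defines "T \<equiv> \<lambda>z. (z - p) / (1 - p * z)"
  assumes z: "z \<noteq> p" "1 - p * z \<noteq> 0"
    and m: "(m has_field_derivative m') (at (T z))" "m' * (1 - T z * \<phi>) = 2 * \<phi> * m (T z)"
    and ne: "1 - T z * \<phi> \<noteq> 0" "1 + p * \<phi> \<noteq> 0"
    and \<psi>: "\<psi> = (\<phi> + p) / (1 + p * \<phi>)"
  shows "((\<lambda>z. c * (T z * m (T z))) has_field_derivative c * (T z * m (T z)) *
           (2 * \<psi> / (1 - z * \<psi>) + 1 / (z - p) - p / (1 - p * z))) (at z)"
proof -
  define u where "u = 1 - p * z"
  have u: "u \<noteq> 0" "z - p \<noteq> 0" using z by (auto simp: u_def)
  have Tz: "T z = (z - p) / u" by (simp add: T_def u_def)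
  have T': "(T has_field_derivative (1 - p\<^sup>2) / u\<^sup>2) (at z)"
    unfolding T_def u_def using z
    by (auto intro!: derivative_eq_intros simp: power2_eq_square divide_simps) (simp add: algebra_simps)
  have "1 - z * \<psi> = u * (1 - T z * \<phi>) / (1 + p * \<phi>)"
    using ne(2) u unfolding \<psi> Tz by (simp add: divide_simps) (simp add: u_def algebra_simps)
  then have "2 * \<psi> / (1 - z * \<psi>) = 2 * (\<phi> + p) / (u * (1 - T z * \<phi>))"
    using ne u unfolding \<psi> by simp
  \<comment> \<open>The summand \<open>2 * p / u\<close> changes the sign of \<open>- p / u\<close>,
    and \<open>1 / (z - p) + p / u\<close> is the logarithmic derivative of
    \<open>T\<close>.\<close>
  also have "\<dots> = 2 * p / u + (1 - p\<^sup>2) / u\<^sup>2 * (2 * \<phi> / (1 - T z * \<phi>))"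
  proof -
    have "2 * (\<phi> + p) * u = 2 * p * u * (1 - T z * \<phi>) + (1 - p\<^sup>2) * (2 * \<phi>)"
      using u unfolding Tz by (simp add: divide_simps) (simp add: u_def algebra_simps power2_eq_square)
    then show ?thesis using ne u by (simp add: divide_simps power2_eq_square)
  qed
  finally have "2 * \<psi> / (1 - z * \<psi>) + 1 / (z - p) - p / u =
      (1 / (z - p) + p / u) + (1 - p\<^sup>2) / u\<^sup>2 * (2 * \<phi> / (1 - T z * \<phi>))"
    by simp
  also have "1 / (z - p) + p / u = (1 - p\<^sup>2) / u\<^sup>2 / T z"
    using u unfolding Tz by (simp add: divide_simps u_def) (simp add: algebra_simps power2_eq_square)
  finally have L: "2 * \<psi> / (1 - z * \<psi>) + 1 / (z - p) - p / u =
     (1 - p\<^sup>2) / u\<^sup>2 * (1 / T z + 2 * \<phi> / (1 - T z * \<phi>))"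
    by (simp add: distrib_left)
  have m': "m' = 2 * \<phi> / (1 - T z * \<phi>) * m (T z)"
    using m(2) ne by (simp add: divide_simps)
  have "T z \<noteq> 0" using u by (simp add: Tz)
  then have "c * (T z * m (T z)) * ((1 - p\<^sup>2) / u\<^sup>2 * (1 / T z + 2 * \<phi> / (1 - T z * \<phi>)))
     = c * ((1 - p\<^sup>2) / u\<^sup>2 * (m (T z) + T z * m'))"
    unfolding m' by (simp add: algebra_simps)
  moreover have "((\<lambda>z. c * (T z * m (T z))) has_field_derivative
      c * ((1 - p\<^sup>2) / u\<^sup>2 * (m (T z) + T z * m'))) (at z)"
    by (rule DERIV_cong[OF DERIV_cmult[OF DERIV_mult[OF T' DERIV_chain2[OF m(1) T']]]])
       (simp only: distrib_left distrib_right mult_ac add_ac)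
  ultimately show ?thesis using L by (simp only: u_def)
qed

section \<open>Necessity: from a function of the class to a bounded function\<close>

text \<open>The quotient \<open>z * k' / k\<close> has nonnegative real part, so its Cayley
  transform is bounded by 1. That transform is \<open>z * \<phi> z\<close>, and the Schwarz lemma
  removes the factor \<open>z\<close> without losing the bound.\<close>

lemma starlike_imp_Schwarz_function:
  assumes k: "k holomorphic_on ball 0 1" "inj_on k (ball 0 1)" "k 0 = 0"
    and star: "\<And>v t. \<lbrakk>v \<in> k ` ball 0 1; 0 \<le> t; t \<le> 1\<rbrakk> \<Longrightarrow> of_real t * v \<in> k ` ball 0 1"
  obtains m \<phi> where "m holomorphic_on ball 0 1" "\<phi> holomorphic_on ball 0 1"
    "\<And>z. norm z < 1 \<Longrightarrow> k z = z * m z"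
    "\<And>z. norm z < 1 \<Longrightarrow> norm (\<phi> z) \<le> 1"
    "\<And>z. norm z < 1 \<Longrightarrow> deriv m z * (1 - z * \<phi> z) = 2 * \<phi> z * m z"
proof -
  obtain m where m: "m holomorphic_on ball 0 1"
    and km: "\<And>z. norm z < 1 \<Longrightarrow> k z = z * m z" and m0: "deriv k 0 = m 0"
    using Schwarz3[OF k(1) k(3)] by metis
  have m_ne: "m z \<noteq> 0" if z: "norm z < 1" for z
  proof (cases "z = 0")
    case True
    then show ?thesis
      using holomorphic_injective_imp_regular[OF k(1) open_ball k(2), of 0] m0 by simp
  next
    case False
    then have "k z \<noteq> k 0" using inj_onD[OF k(2), of z 0] z by auto
    then show ?thesis using km[OF z] k(3) by auto
  qed
  have dm: "(m has_field_derivative deriv m z) (at z)" if "norm z < 1" for z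
    using holomorphic_derivI[OF m open_ball] that by simp
  have dk: "deriv k z = m z + z * deriv m z" if z: "norm z < 1" for z
  proof -
    have "((\<lambda>z. z * m z) has_field_derivative m z + z * deriv m z) (at z)"
      using DERIV_mult[OF DERIV_ident dm[OF z]] by (simp add: algebra_simps)
    moreover have "\<forall>\<^sub>F x in nhds z. k x = x * m x"
      using eventually_nhds_in_open[of "ball 0 1" z] z km by (auto elim!: eventually_mono)
    ultimately show ?thesis
      by (metis DERIV_imp_deriv deriv_cong_ev)
  qed
  \<comment> \<open>This is \<open>z * k' / k\<close> written through \<open>m\<close>, which gives
    the correct value 1 at the origin instead of a quotient \<open>0 / 0\<close>.\<close>
  define q where "q = (\<lambda>z. 1 + z * deriv m z / m z)"
  have q: "0 \<le> Re (q z)" if z: "norm z < 1" for z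
  proof (cases "z = 0")
    case False
    have "q z = z * deriv k z / k z"
      using False m_ne[OF z] by (simp add: dk[OF z] km[OF z] q_def field_simps)
    then show ?thesis using starlike_imp_Re_nonneg[OF k star z] by simp
  qed (simp add: q_def)
  have den: "2 * m z + z * deriv m z = m z * (q z + 1)" if "norm z < 1" for z
    using m_ne[OF that] by (simp add: q_def field_simps)
  have den_ne: "2 * m z + z * deriv m z \<noteq> 0" if z: "norm z < 1" for z
  proof -
    have "Re (q z + 1) \<noteq> 0" using q[OF z] by simp
    then have "q z + 1 \<noteq> 0" by (metis zero_complex.sel(1))
    then show ?thesis using m_ne[OF z] unfolding den[OF z] by simp
  qed
  \<comment> \<open>The Cayley transform \<open>(q - 1) / (q + 1)\<close> with the factor
    \<open>z\<close> already cancelled, so that 0 is not a special point.\<close>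
  define \<phi> where "\<phi> = (\<lambda>z. deriv m z / (2 * m z + z * deriv m z))"
  have hol: "\<phi> holomorphic_on ball 0 1"
    unfolding \<phi>_def using den_ne by (intro holomorphic_intros m holomorphic_deriv) auto
  have hol': "(\<lambda>z. z * \<phi> z) holomorphic_on ball 0 1" by (intro holomorphic_intros hol)
  have le: "norm (z * \<phi> z) \<le> 1" if z: "norm z < 1" for z
  proof -
    have "z * \<phi> z = (q z - 1) / (q z + 1)"
      using m_ne[OF z] den_ne[OF z] unfolding \<phi>_def by (simp add: q_def field_simps)
    moreover have "norm (q z - 1) \<le> norm (q z + 1)"
    proof (rule power2_le_imp_le)
      show "(norm (q z - 1))\<^sup>2 \<le> (norm (q z + 1))\<^sup>2"
        unfolding cmod_power2 using q[OF z] by (simp add: power2_eq_square algebra_simps)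
    qed simp
    ultimately show ?thesis by (simp add: norm_divide divide_le_eq_1)
  qed
  have \<phi>: "norm (\<phi> z) \<le> 1" if z: "norm z < 1" for z
  proof (cases "z = 0")
    \<comment> \<open>At the origin \<open>\<phi> 0\<close> is the derivative of
      \<open>z * \<phi> z\<close>, which Schwarz-Pick bounds by 1.\<close>
    case True
    have "(\<phi> has_field_derivative deriv \<phi> 0) (at 0)"
      using holomorphic_derivI[OF hol open_ball] by simp
    from DERIV_mult[OF DERIV_ident this] have "deriv (\<lambda>z. z * \<phi> z) 0 = \<phi> 0"
      by (intro DERIV_imp_deriv) simp
    then show ?thesis using Schwarz_Pick_at_0[OF hol' le] True by simp
  next
    case False
    have "norm (z * \<phi> z) \<le> norm z" by (rule Schwarz_Lemma_closed[OF hol' _ le z]) auto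
    then show ?thesis using False by (simp add: norm_mult)
  qed
  have "deriv m z * (1 - z * \<phi> z) = 2 * \<phi> z * m z" if "norm z < 1" for z
    using den_ne[OF that] by (simp add: \<phi>_def field_simps)
  with m hol km \<phi> show thesis by (intro that)
qed

text \<open>Inversion about the omitted value \<open>w\<close> sends the pole to a zero. It sends
  the complement, starlike about \<open>w\<close>, to the outside of an image that is starlike about
  0.\<close>

lemma Sigma_star_D:
  assumes "f \<in> Sigma_star p w"
  shows "f holomorphic_on ball 0 1 - {of_real p}"
    and "(\<lambda>z. if z = of_real p then 0 else inverse (f z - w)) holomorphic_on ball 0 1"
    and "inj_on (\<lambda>z. if z = of_real p then 0 else inverse (f z - w)) (ball 0 1)"
    and "\<And>z. norm z < 1 \<Longrightarrow> z \<noteq> of_real p \<Longrightarrow> f z \<noteq> w"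
    and "\<And>v t. \<lbrakk>v \<in> (\<lambda>z. if z = of_real p then 0 else inverse (f z - w)) ` ball 0 1; 0 \<le> t; t \<le> 1\<rbrakk> \<Longrightarrow>
      of_real t * v \<in> (\<lambda>z. if z = of_real p then 0 else inverse (f z - w)) ` ball 0 1"
proof -
  let ?p = "complex_of_real p"
  define h where "h = (\<lambda>z. if z = ?p then 0 else inverse (f z - w))"
  have mero: "f nicely_meromorphic_on ball 0 1" and inj: "inj_on (ext_val f) (ball 0 1)"
    and poles: "{z \<in> ball 0 1. is_pole f z} = {?p}"
    and star: "starlike_wrt w (- (ext_val f ` ball 0 1))"
    using assms by (auto simp: Sigma_star_def)
  have pole: "is_pole f ?p" and p1: "?p \<in> ball 0 1" using poles by blast+
  have ext: "ext_val f z = Some (f z)" if "z \<in> ball 0 1" "z \<noteq> ?p" for z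
    using poles that by (auto simp: ext_val_def)
  have ext_p: "ext_val f ?p = None" using pole by (simp add: ext_val_def)
  have "f analytic_on {z}" if "z \<in> ball 0 1 - {?p}" for z
    using nicely_meromorphic_on_imp_analytic_at[OF mero, of z] poles that by auto
  then have "f analytic_on ball 0 1 - {?p}" by (metis analytic_on_analytic_at)
  then show hol: "f holomorphic_on ball 0 1 - {?p}" by (rule analytic_imp_holomorphic)
  have "Some w \<notin> ext_val f ` ball 0 1" using star by (auto simp: starlike_wrt_def)
  then show ne: "f z \<noteq> w" if "norm z < 1" "z \<noteq> ?p" for z
    using ext[of z] that by force
  have "is_pole (\<lambda>z. - w + f z) ?p"
    using pole unfolding is_pole_def by (rule tendsto_add_filterlim_at_infinity[OF tendsto_const])
  then have pole': "is_pole (\<lambda>z. f z - w) ?p" by simp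
  show "h holomorphic_on ball 0 1" unfolding h_def
    by (rule is_pole_inverse_holomorphic[OF open_ball _ pole']) (use hol ne in \<open>auto intro!: holomorphic_intros\<close>)
  show "inj_on h (ball 0 1)"
  proof (rule inj_onI)
    fix a b assume a: "a \<in> ball 0 1" and b: "b \<in> ball 0 1" and eq: "h a = h b"
    show "a = b"
    proof (cases "a = ?p \<or> b = ?p")
      case True
      then show ?thesis using eq ne[of a] ne[of b] a b by (auto simp: h_def split: if_splits)
    next
      case False
      then have "ext_val f a = ext_val f b" using eq a b by (simp add: h_def ext)
      then show ?thesis using inj_onD[OF inj] a b by blast
    qed
  qed
  fix v t assume v: "v \<in> h ` ball 0 1" and t: "0 \<le> t" "t \<le> (1::real)"
  then obtain x where x: "x \<in> ball 0 1" "v = h x" by auto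
  show "of_real t * v \<in> h ` ball 0 1"
  proof (cases "x = ?p \<or> t = 0")
    case True
    then have "of_real t * v = h ?p" by (auto simp: x h_def)
    then show ?thesis using p1 by blast
  next
    case False
    \<comment> \<open>The point beyond \<open>f x\<close> on the ray from \<open>w\<close> at which
      the inversion takes the value \<open>t * h x\<close>. If \<open>f\<close> omitted it,
      starlikeness of the complement would make \<open>f\<close> omit \<open>f x\<close>
      too.\<close>
    define u where "u = w + (f x - w) / of_real t"
    have "Some u \<in> ext_val f ` ball 0 1"
    proof (rule ccontr)
      assume "\<not> ?thesis"
      then have "Some ` closed_segment w u \<subseteq> - (ext_val f ` ball 0 1)"
        using star unfolding starlike_wrt_def by (metis ComplI option.inject)
      moreover have fx: "f x \<in> closed_segment w u"
      proof -
        have "f x = (1 - t) *\<^sub>R w + t *\<^sub>R u"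
          using False by (simp add: u_def scaleR_conv_of_real field_simps)
        then show ?thesis using t unfolding closed_segment_def by blast
      qed
      ultimately have "Some (f x) \<notin> ext_val f ` ball 0 1" by blast
      moreover have "Some (f x) = ext_val f x" using ext[of x] x(1) False by simp
      ultimately show False using x(1) by (metis image_eqI)
    qed
    then obtain y where y: "y \<in> ball 0 1" "ext_val f y = Some u" by auto
    then have "y \<noteq> ?p" using ext_p by auto
    then have "f y = u" using ext y by simp
    then have "h y = of_real t * v"
      using False \<open>y \<noteq> ?p\<close> by (simp add: h_def x u_def inverse_eq_divide)
    then show ?thesis using y(1) by (metis image_eqI)
  qed
qed

text \<open>Moving the zero of \<open>h\<close> from \<open>p\<close> to 0 by \<open>S\<close>, the
  inverse of \<open>T\<close>, gives a starlike \<open>k\<close>. Its function \<open>\<phi>\<close>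
  is pulled back along \<open>T\<close>, and the equation for \<open>h\<close> is rewritten for
  \<open>f = w + 1 / h\<close>.\<close>

lemma Sigma_star_parametrization:
  assumes p: "0 < p" "p < 1" and f: "f \<in> Sigma_star p w"
  obtains \<psi> where "\<psi> holomorphic_on ball 0 1" "\<And>z. norm z < 1 \<Longrightarrow> norm (\<psi> z) \<le> 1"
    "\<And>z. norm z < 1 \<Longrightarrow> z \<noteq> of_real p \<Longrightarrow> deriv f z = (w - f z) *
       (2 * \<psi> z / (1 - z * \<psi> z) + 1 / (z - of_real p) - of_real p / (1 - of_real p * z))"
proof -
  let ?p = "complex_of_real p"
  define h where "h = (\<lambda>z. if z = ?p then 0 else inverse (f z - w))"
  note F = Sigma_star_D[OF f, folded h_def]
  define T where "T = Moebius_function 0 ?p"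
  define S where "S = Moebius_function 0 (- ?p)"
  have np: "norm ?p < 1" using p by simp
  have T: "T holomorphic_on ball 0 1" "norm (T z) < 1" if "norm z < 1" for z
    unfolding T_def using Moebius_function_holomorphic[OF np] Moebius_function_norm_lt_1[OF np that] by auto
  have S: "S holomorphic_on ball 0 1" "norm (S z) < 1" if "norm z < 1" for z
    unfolding S_def using Moebius_function_holomorphic[of "-?p"] Moebius_function_norm_lt_1[of "-?p" z] np that by auto
  have ST: "S (T z) = z" if "norm z < 1" for z
    unfolding S_def T_def by (rule Moebius_function_compose) (use np that in auto)
  have TS: "T (S z) = z" if "norm z < 1" for z
    unfolding S_def T_def by (rule Moebius_function_compose) (use np that in auto)
  define k where "k = h \<circ> S"
  have S_im: "S ` ball 0 1 = ball 0 1"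
    using S(2) T(2) ST by (auto simp: image_iff) (metis mem_ball_0)
  have k_im: "k ` ball 0 1 = h ` ball 0 1" by (simp only: k_def image_comp[symmetric] S_im)
  have "k holomorphic_on ball 0 1"
    unfolding k_def by (rule holomorphic_on_compose[OF S(1)[of 0]]) (use F(2) S_im in auto)
  moreover have "inj_on k (ball 0 1)"
    unfolding k_def
    by (rule comp_inj_on[OF inj_on_inverseI[where g = T]]) (use TS S_im F(3) in auto)
  moreover have "k 0 = 0" by (simp add: k_def h_def S_def Moebius_function_of_zero)
  moreover have "of_real t * v \<in> k ` ball 0 1" if "v \<in> k ` ball 0 1" "0 \<le> t" "t \<le> 1" for v t
    using F(5)[of v t] that unfolding k_im by simp
  ultimately obtain m \<phi> where m: "m holomorphic_on ball 0 1" and \<phi>: "\<phi> holomorphic_on ball 0 1"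
    and km: "\<And>z. norm z < 1 \<Longrightarrow> k z = z * m z"
    and \<phi>1: "\<And>z. norm z < 1 \<Longrightarrow> norm (\<phi> z) \<le> 1"
    and m': "\<And>z. norm z < 1 \<Longrightarrow> deriv m z * (1 - z * \<phi> z) = 2 * \<phi> z * m z"
    using starlike_imp_Schwarz_function by metis
  define \<psi> where "\<psi> = (\<lambda>z. (\<phi> (T z) + ?p) / (1 + ?p * \<phi> (T z)))"
  have \<psi>_ne: "1 + ?p * \<phi> (T z) \<noteq> 0" and \<psi>1: "norm (\<psi> z) \<le> 1" if "norm z < 1" for z
    using norm_disc_automorphism_le_1[OF \<phi>1[OF T(2)[OF that]], of p] p unfolding \<psi>_def by auto
  have \<phi>T: "(\<lambda>z. \<phi> (T z)) holomorphic_on ball 0 1"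
    by (rule holomorphic_on_compose_gen[OF T(1)[of 0] \<phi>, unfolded o_def]) (use T(2) in auto)
  have "\<psi> holomorphic_on ball 0 1"
    unfolding \<psi>_def using \<psi>_ne by (intro holomorphic_intros \<phi>T) auto
  moreover have "deriv f z = (w - f z) * (2 * \<psi> z / (1 - z * \<psi> z) + 1 / (z - ?p) - ?p / (1 - ?p * z))"
    if z: "norm z < 1" "z \<noteq> ?p" for z
  proof -
    define L where "L = 2 * \<psi> z / (1 - z * \<psi> z) + 1 / (z - ?p) - ?p / (1 - ?p * z)"
    have Tz: "T z = (z - ?p) / (1 - ?p * z)" for z by (simp add: T_def Moebius_function_simple)
    have lt: "norm (a * b) < 1" if "norm a < 1" "norm b \<le> 1" for a b :: complex
      using mult_left_le[of "norm b" "norm a"] that by (simp add: norm_mult)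
    have ne1: "1 - a \<noteq> 0" if "norm a < 1" for a :: complex using that by auto
    have "(m has_field_derivative deriv m (T z)) (at (T z))"
      using holomorphic_derivI[OF m open_ball] T(2)[OF z(1)] by simp
    from moebius_pullback_log_deriv[where p = ?p and c = 1, folded Tz, OF z(2) _ this m'[OF T(2)[OF z(1)]] _ \<psi>_ne[OF z(1)] refl,
        folded \<psi>_def]
    have D: "((\<lambda>z. T z * m (T z)) has_field_derivative T z * m (T z) * L) (at z)"
      using ne1[OF lt[OF np]] ne1[OF lt[OF T(2)[OF z(1)] \<phi>1[OF T(2)[OF z(1)]]]] z(1)
      by (auto simp: L_def \<psi>_def)
    have hT: "h z = T z * m (T z)" if "norm z < 1" for z
      using km[OF T(2)[OF that]] ST[OF that] by (simp add: k_def)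
    have "open (ball 0 1 - {?p})" by (intro open_Diff) auto
    then have ev: "\<forall>\<^sub>F x in nhds z. x \<in> ball 0 1 - {?p}"
      using z by (intro eventually_nhds_in_open) auto
    have D': "((\<lambda>z. w + inverse (T z * m (T z))) has_field_derivative
        - (inverse (h z) * (h z * L) * inverse (h z))) (at z)"
      using DERIV_add[OF DERIV_const DERIV_inverse'[OF D]] F(4)[OF z] z by (simp add: hT[symmetric] h_def)
    have "deriv f z = deriv (\<lambda>z. w + inverse (T z * m (T z))) z"
      by (rule deriv_cong_ev[OF eventually_mono[OF ev]]) (auto simp: hT[symmetric] h_def)
    also have "\<dots> = - (inverse (h z) * (h z * L) * inverse (h z))"
      by (rule DERIV_imp_deriv[OF D'])
    also have "\<dots> = (w - f z) * L"
      using F(4)[OF z] z by (simp add: h_def field_simps)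
    finally show ?thesis by (simp add: L_def)
  qed
  ultimately show thesis using \<psi>1 by (intro that)
qed

section \<open>Sufficiency: from a bounded function to a function of the class\<close>

text \<open>\<open>M\<close> plays the role of \<open>log (k z / z)\<close>. With
  \<open>a = z * \<phi> z\<close> of modulus below 1, \<open>1 + z * deriv M z\<close> is
  \<open>(1 + a) / (1 - a)\<close>, whose real part is positive, so
  \<open>starlike_criterion\<close> applies.\<close>

lemma Schwarz_function_imp_starlike:
  assumes \<phi>: "\<phi> holomorphic_on ball 0 1" "\<And>z. norm z < 1 \<Longrightarrow> norm (\<phi> z) \<le> 1"
  obtains M where "M holomorphic_on ball 0 1"
    "\<And>z. norm z < 1 \<Longrightarrow> (M has_field_derivative 2 * \<phi> z / (1 - z * \<phi> z)) (at z)"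
    "inj_on (\<lambda>z. z * exp (M z)) (ball 0 1)"
    "\<And>v t. \<lbrakk>v \<in> (\<lambda>z. z * exp (M z)) ` ball 0 1; 0 \<le> t; t \<le> 1\<rbrakk> \<Longrightarrow>
      of_real t * v \<in> (\<lambda>z. z * exp (M z)) ` ball 0 1"
proof -
  have lt: "norm (z * \<phi> z) < 1" if "norm z < 1" for z
    using mult_left_le[OF \<phi>(2)[OF that], of "norm z"] that by (simp add: norm_mult)
  have ne: "1 - z * \<phi> z \<noteq> 0" if "norm z < 1" for z using lt[OF that] by auto
  have hol: "(\<lambda>z. 2 * \<phi> z / (1 - z * \<phi> z)) holomorphic_on ball 0 1"
    using ne by (intro holomorphic_intros \<phi>(1)) auto
  obtain M where "\<And>z. z \<in> ball 0 1 \<Longrightarrow>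
      (M has_field_derivative 2 * \<phi> z / (1 - z * \<phi> z)) (at z within ball 0 1)"
    by (rule holomorphic_convex_primitive'[OF convex_ball open_ball hol]) (rule that)
  then have M': "(M has_field_derivative 2 * \<phi> z / (1 - z * \<phi> z)) (at z)" if "norm z < 1" for z
    using that by (metis at_within_open mem_ball_0 open_ball)
  have M: "M holomorphic_on ball 0 1"
    unfolding holomorphic_on_open[OF open_ball] using M' by (metis mem_ball_0)
  have pos: "0 < Re (1 + z * deriv M z)" if z: "norm z < 1" for z
  proof -
    define a where "a = z * \<phi> z"
    have "1 + z * deriv M z = (1 + a) / (1 - a)"
      using ne[OF z] by (simp add: DERIV_imp_deriv[OF M'[OF z]] a_def field_simps)
    moreover have "Re ((1 + a) / (1 - a)) = (1 - (norm a)\<^sup>2) / (norm (1 - a))\<^sup>2"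
      unfolding Re_divide' cmod_power2 by (simp add: power2_eq_square algebra_simps)
    moreover have "(norm a)\<^sup>2 < 1" "norm (1 - a) > 0"
      using lt[OF z] ne[OF z] by (auto simp: a_def abs_square_less_1)
    ultimately show ?thesis by simp
  qed
  have inj: "inj_on (\<lambda>z. z * exp (M z)) (ball 0 1)"
    by (rule starlike_criterion(1)[OF M pos])
  have star: "of_real t * v \<in> (\<lambda>z. z * exp (M z)) ` ball 0 1"
    if "v \<in> (\<lambda>z. z * exp (M z)) ` ball 0 1" "0 \<le> t" "t \<le> 1" for v t
    using that by (intro starlike_criterion(2)[OF M] pos)
  show thesis by (rule that[OF M M' inj star])
qed

text \<open>The necessity argument is run backwards: \<open>\<psi>\<close> gives
  \<open>\<phi>\<close>, integration gives a starlike \<open>k\<close>, and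
  \<open>f = w + 1 / (c * k(T))\<close>. The condition on \<open>\<psi> 0\<close> is exactly
  \<open>deriv f 0 = 1\<close>.\<close>

lemma Sigma_star_realization:
  fixes w :: complex
  assumes p: "0 < p" "p < 1" and w: "w \<noteq> 0"
    and \<psi>: "\<psi> holomorphic_on ball 0 1" "\<And>z. norm z < 1 \<Longrightarrow> norm (\<psi> z) \<le> 1"
    and \<psi>0: "w * (2 * \<psi> 0 - (of_real p + 1 / of_real p)) = 1"
  obtains f where "f \<in> Sigma_star p w"
    "\<And>z. norm z < 1 \<Longrightarrow> z \<noteq> of_real p \<Longrightarrow> deriv f z = (w - f z) *
       (2 * \<psi> z / (1 - z * \<psi> z) + 1 / (z - of_real p) - of_real p / (1 - of_real p * z))"
proof -
  let ?p = "complex_of_real p"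
  define T where "T = Moebius_function 0 ?p"
  define S where "S = Moebius_function 0 (- ?p)"
  have np: "norm ?p < 1" using p by simp
  have T: "T holomorphic_on ball 0 1" "norm (T z) < 1" if "norm z < 1" for z
    unfolding T_def using Moebius_function_holomorphic[OF np] Moebius_function_norm_lt_1[OF np that] by auto
  have S: "S holomorphic_on ball 0 1" "norm (S z) < 1" if "norm z < 1" for z
    unfolding S_def using Moebius_function_holomorphic[of "-?p"] Moebius_function_norm_lt_1[of "-?p" z] np that by auto
  have ST: "S (T z) = z" if "norm z < 1" for z
    unfolding S_def T_def by (rule Moebius_function_compose) (use np that in auto)
  have TS: "T (S z) = z" if "norm z < 1" for z
    unfolding S_def T_def by (rule Moebius_function_compose) (use np that in auto)
  have Tz: "T z = (z - ?p) / (1 - ?p * z)" for z by (simp add: T_def Moebius_function_simple)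
  have lt: "norm (a * b) < 1" if "norm a < 1" "norm b \<le> 1" for a b :: complex
    using mult_left_le[of "norm b" "norm a"] that by (simp add: norm_mult)
  have ne1: "1 - a \<noteq> 0" if "norm a < 1" for a :: complex using that by auto
  have pz: "1 - ?p * z \<noteq> 0" if "norm z < 1" for z
    by (rule ne1[OF lt[OF np]]) (use that in simp)
  have T0: "T z = 0 \<longleftrightarrow> z = ?p" if "norm z < 1" for z using pz[OF that] by (simp add: Tz)
  \<comment> \<open>This inverts the substitution \<open>\<psi> = (\<phi> \<circ> T + p) / (1 + p *
    (\<phi> \<circ> T))\<close>, hence the sign change of \<open>p\<close>.\<close>
  define \<phi> where "\<phi> = (\<lambda>z. (\<psi> (S z) - ?p) / (1 - ?p * \<psi> (S z)))"
  have \<phi>_ne: "1 - ?p * \<psi> (S z) \<noteq> 0" and \<phi>1: "norm (\<phi> z) \<le> 1" if "norm z < 1" for z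
    using norm_disc_automorphism_le_1[OF \<psi>(2)[OF S(2)[OF that]], of "-p"] p unfolding \<phi>_def by auto
  have \<psi>S: "(\<lambda>z. \<psi> (S z)) holomorphic_on ball 0 1"
    by (rule holomorphic_on_compose_gen[OF S(1)[of 0] \<psi>(1), unfolded o_def]) (use S(2) in auto)
  have \<phi>: "\<phi> holomorphic_on ball 0 1"
    unfolding \<phi>_def using \<phi>_ne by (intro holomorphic_intros \<psi>S) auto
  obtain M where M: "M holomorphic_on ball 0 1"
    and M': "\<And>z. norm z < 1 \<Longrightarrow> (M has_field_derivative 2 * \<phi> z / (1 - z * \<phi> z)) (at z)"
    and inj: "inj_on (\<lambda>z. z * exp (M z)) (ball 0 1)"
    and star: "\<And>v t. \<lbrakk>v \<in> (\<lambda>z. z * exp (M z)) ` ball 0 1; 0 \<le> t; t \<le> 1\<rbrakk> \<Longrightarrow>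
      of_real t * v \<in> (\<lambda>z. z * exp (M z)) ` ball 0 1"
    by (rule Schwarz_function_imp_starlike[OF \<phi>]) (rule \<phi>1, assumption, rule that)
  define k where "k = (\<lambda>z. z * exp (M z))"
  \<comment> \<open>As \<open>T 0 = - p\<close>, this constant makes \<open>h 0 = - 1 / w\<close>,
    and so \<open>f 0 = 0\<close>.\<close>
  define c where "c = - 1 / (w * k (- ?p))"
  have k0: "k z = 0 \<longleftrightarrow> z = 0" for z by (simp add: k_def)
  have c: "c \<noteq> 0" using w p by (simp add: c_def k0)
  define h where "h = (\<lambda>z. c * k (T z))"
  have h0: "h z = 0 \<longleftrightarrow> z = ?p" if "norm z < 1" for z using that c by (simp add: h_def k0 T0)
  have h_inj: "inj_on h (ball 0 1)"
  proof (rule inj_onI)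
    fix a b assume a: "a \<in> ball 0 1" and b: "b \<in> ball 0 1" and "h a = h b"
    then have "k (T a) = k (T b)" using c by (simp add: h_def)
    then have "T a = T b" using inj_onD[OF inj, of "T a" "T b"] T(2) a b by (simp add: k_def)
    then show "a = b" using ST a b by (metis mem_ball_0)
  qed
  have h_star: "\<exists>y. norm y < 1 \<and> h y = of_real t * h x" if "norm x < 1" "0 \<le> t" "t \<le> 1" for x t
  proof -
    have "of_real t * k (T x) \<in> k ` ball 0 1"
      unfolding k_def by (rule star) (use that T(2) in auto)
    then obtain y where "norm y < 1" "of_real t * k (T x) = k y" by auto
    then show ?thesis using TS[of y] S(2)[of y] by (intro exI[of _ "S y"]) (simp add: h_def)
  qed
  have MT: "(\<lambda>z. M (T z)) holomorphic_on ball 0 1"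
    by (rule holomorphic_on_compose_gen[OF T(1)[of 0] M, unfolded o_def]) (use T(2) in auto)
  \<comment> \<open>The value 0 at the pole is the one that \<open>nicely_meromorphic_on\<close>
    prescribes.\<close>
  define f where "f = (\<lambda>z. if z = ?p then 0 else w + inverse (h z))"
  define D where "D = ball 0 1 - {?p}"
  have oD: "open D" unfolding D_def by (intro open_Diff) auto
  have h_hol: "h holomorphic_on ball 0 1"
    unfolding h_def k_def by (intro holomorphic_intros T(1)[of 0] MT) auto
  have f_hol: "f holomorphic_on D"
  proof (rule holomorphic_transform)
    show "(\<lambda>z. w + inverse (h z)) holomorphic_on D"
      using h0 by (intro holomorphic_intros holomorphic_on_subset[OF h_hol]) (auto simp: D_def)
  qed (auto simp: D_def f_def)
  have f_an: "f analytic_on {z}" if "norm z < 1" "z \<noteq> ?p" for z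
    using f_hol oD that unfolding analytic_on_open[OF oD, symmetric]
    by (auto elim!: analytic_on_subset simp: D_def)
  have deriv_f: "deriv f z = (w - f z) * (2 * \<psi> z / (1 - z * \<psi> z) + 1 / (z - ?p) - ?p / (1 - ?p * z))"
    if z: "norm z < 1" "z \<noteq> ?p" for z
  proof -
    define L where "L = 2 * \<psi> z / (1 - z * \<psi> z) + 1 / (z - ?p) - ?p / (1 - ?p * z)"
    note Tz1 = T(2)[OF z(1)]
    have ne: "1 - T z * \<phi> (T z) \<noteq> 0" by (rule ne1[OF lt[OF Tz1 \<phi>1[OF Tz1]]])
    have \<phi>T: "\<phi> (T z) = (\<psi> z - ?p) / (1 - ?p * \<psi> z)" by (simp add: \<phi>_def ST[OF z(1)])
    have ne': "1 - ?p * \<psi> z \<noteq> 0" by (rule ne1[OF lt[OF np \<psi>(2)[OF z(1)]]])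
    have pp: "1 - ?p * ?p \<noteq> 0" by (rule ne1[OF lt[OF np]]) (use np in simp)
    have eqs: "1 + ?p * \<phi> (T z) = (1 - ?p * ?p) / (1 - ?p * \<psi> z)"
        "\<phi> (T z) + ?p = \<psi> z * (1 - ?p * ?p) / (1 - ?p * \<psi> z)"
      using ne' by (simp_all add: \<phi>T field_simps)
    have "((\<lambda>z. exp (M z)) has_field_derivative exp (M (T z)) * (2 * \<phi> (T z) / (1 - T z * \<phi> (T z)))) (at (T z))"
      by (rule DERIV_chain2[OF DERIV_exp M'[OF Tz1]])
    from moebius_pullback_log_deriv[where p = ?p and c = c, folded Tz, OF z(2) pz[OF z(1)] this _ ne _ refl]
    have "(h has_field_derivative h z * (2 * ((\<phi> (T z) + ?p) / (1 + ?p * \<phi> (T z))) /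
         (1 - z * ((\<phi> (T z) + ?p) / (1 + ?p * \<phi> (T z)))) + 1 / (z - ?p) - ?p / (1 - ?p * z))) (at z)"
      using ne ne' pp unfolding h_def k_def by (simp add: eqs)
    then have D: "(h has_field_derivative h z * L) (at z)"
      using ne' pp by (simp add: eqs L_def)
    have hz: "h z \<noteq> 0" using h0 z by simp
    have "((\<lambda>z. w + inverse (h z)) has_field_derivative - (inverse (h z) * (h z * L) * inverse (h z))) (at z)"
      using DERIV_add[OF DERIV_const DERIV_inverse'[OF D hz]] by simp
    then have "deriv (\<lambda>z. w + inverse (h z)) z = - (inverse (h z) * (h z * L) * inverse (h z))"
      by (rule DERIV_imp_deriv)
    moreover have "deriv f z = deriv (\<lambda>z. w + inverse (h z)) z"
      by (rule deriv_cong_ev[OF eventually_mono[OF eventually_nhds_in_open[OF oD]]])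
         (use z in \<open>auto simp: D_def f_def\<close>)
    ultimately have "deriv f z = (w - f z) * L"
      using hz z by (simp add: f_def)
    then show ?thesis by (simp add: L_def)
  qed
  have p1: "?p \<in> ball 0 1" using np by simp
  have pole: "is_pole f ?p"
  proof -
    have lim: "h \<midarrow>?p\<rightarrow> 0"
      using holomorphic_on_imp_continuous_on[OF h_hol] h0[of ?p] np p1
      by (metis continuous_on_eq_continuous_at isCont_def open_ball)
    have ev: "\<forall>\<^sub>F z in at ?p. z \<in> D"
      using eventually_at_in_open[OF open_ball p1] unfolding D_def by simp
    have "filterlim h (at 0) (at ?p)"
      using lim by (auto simp: filterlim_at h0 D_def intro!: eventually_mono[OF ev])
    then have "LIM z at ?p. inverse (h z) :> at_infinity"
      by (rule filterlim_compose[OF filterlim_inverse_at_infinity])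
    then have "is_pole (\<lambda>z. w + inverse (h z)) ?p"
      unfolding is_pole_def by (rule tendsto_add_filterlim_at_infinity[OF tendsto_const])
    then show ?thesis
      by (rule is_pole_transform[OF _ eventually_mono[OF ev] refl]) (auto simp: f_def D_def)
  qed
  have not_pole: "\<not> is_pole f z" if "norm z < 1" "z \<noteq> ?p" for z
    using f_an[OF that] by (meson analytic_at_imp_no_pole)
  have ext: "ext_val f z = (if z = ?p then None else Some (w + inverse (h z)))" if "norm z < 1" for z
    using pole not_pole that by (auto simp: ext_val_def f_def)
  have nice: "f nicely_meromorphic_on ball 0 1"
  proof -
    have "f meromorphic_on {z}" if "norm z < 1" for z
    proof (cases "z = ?p")
      case True
      have "isolated_singularity_at f ?p"
        by (rule isolated_singularity_at_holomorphic[OF _ open_ball p1]) (use f_hol in \<open>simp add: D_def\<close>)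
      moreover have "not_essential f ?p" using pole by (auto simp: not_essential_def)
      ultimately show ?thesis using True by (simp add: meromorphic_at_iff)
    next
      case False
      then show ?thesis using f_an[OF that] by (simp add: analytic_on_imp_meromorphic_on)
    qed
    then have "f meromorphic_on ball 0 1"
      by (subst meromorphic_on_meromorphic_at) auto
    moreover have "f \<midarrow>z\<rightarrow> f z" if "norm z < 1" "z \<noteq> ?p" for z
      using analytic_at_imp_isCont[OF f_an[OF that]] by (simp add: isCont_def)
    moreover have "f ?p = 0" by (simp add: f_def)
    ultimately show ?thesis using pole unfolding nicely_meromorphic_on_def by (metis mem_ball_0)
  qed
  have zo: "zorder f ?p = -1"
  proof (rule zorder_eqI[OF open_ball p1])
    \<comment> \<open>This is \<open>(z - p) * f z\<close> after cancelling the zero of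
      \<open>T\<close> at \<open>p\<close>, which leaves a holomorphic function that does not vanish
      there.\<close>
    let ?g = "\<lambda>z. w * (z - ?p) + (1 - ?p * z) * exp (- M (T z)) / c"
    show "?g holomorphic_on ball 0 1" by (intro holomorphic_intros MT) (use c in auto)
    show "?g ?p \<noteq> 0" using pz[of ?p] np c by simp
    fix z assume z: "z \<in> ball 0 1" "z \<noteq> ?p"
    then show "f z = ?g z * (z - ?p) powi - 1"
      using pz[of z] c by (simp add: f_def h_def k_def Tz power_int_minus exp_minus field_simps)
  qed
  have f0: "f 0 = 0"
    using w p c by (simp add: f_def h_def c_def Tz)
  \<comment> \<open>The disc of radius \<open>p\<close> about 0 avoids the pole, so the coefficient
    formulas apply on it.\<close>
  have "f holomorphic_on ball 0 p"
    by (rule holomorphic_on_subset[OF f_hol]) (use p in \<open>auto simp: D_def\<close>)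
  moreover have "\<psi> holomorphic_on ball 0 p"
    by (rule holomorphic_on_subset[OF \<psi>(1)]) (use p in auto)
  moreover have "deriv f z = (w - f z) * (2 * \<psi> z / (1 - z * \<psi> z) + 1 / (z - ?p) - ?p / (1 - ?p * z))"
    if "norm z < p" for z
    by (rule deriv_f) (use that p in auto)
  ultimately have df0: "deriv f 0 = 1"
    using taylor_coeff_2_parametrized(1)[of f p w \<psi> ?p] f0 p \<psi>0 by simp
  have inj_ext: "inj_on (ext_val f) (ball 0 1)"
  proof (rule inj_onI)
    fix a b assume a: "a \<in> ball 0 1" and b: "b \<in> ball 0 1" and "ext_val f a = ext_val f b"
    then have "h a = h b" using h0 by (auto simp: ext split: if_splits)
    then show "a = b" using inj_onD[OF h_inj] a b by blast
  qed
  have starlike: "starlike_wrt w (- (ext_val f ` ball 0 1))"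
    unfolding starlike_wrt_def
  proof (intro conjI ballI)
    show "Some w \<in> - ext_val f ` ball 0 1"
      using h0 by (auto simp: ext split: if_splits)
    fix x assume x: "x \<in> - ext_val f ` ball 0 1"
    have "None = ext_val f ?p" using pole by (simp add: ext_val_def)
    with x p1 obtain u where u: "x = Some u" by (metis ComplD image_eqI not_None_eq)
    moreover have "Some v \<in> - ext_val f ` ball 0 1" if v: "v \<in> closed_segment w u" for v
    proof
      assume "Some v \<in> ext_val f ` ball 0 1"
      then obtain y where y: "norm y < 1" "y \<noteq> ?p" "v = w + inverse (h y)"
        by (auto simp: ext split: if_splits)
      obtain t where t: "0 \<le> t" "t \<le> 1" "v = (1 - t) *\<^sub>R w + t *\<^sub>R u"
        using v by (auto simp: closed_segment_def)
      have eq: "inverse (h y) = of_real t * (u - w)"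
        using t(3) y(3) by (simp add: scaleR_conv_of_real algebra_simps)
      have hy: "h y \<noteq> 0" using h0 y by simp
      then have "t \<noteq> 0" "u - w \<noteq> 0" using eq by auto
      \<comment> \<open>If \<open>v\<close> were attained at \<open>y\<close>, scaling
        \<open>h y\<close> by \<open>t\<close> would stay in the image of \<open>h\<close> and give
        \<open>1 / (u - w)\<close>. Then \<open>u\<close> itself would be attained.\<close>
      obtain y' where y': "norm y' < 1" "h y' = of_real t * h y" using h_star[OF y(1) t(1,2)] by auto
      have "h y' = inverse (u - w)"
        using y'(2) eq hy \<open>t \<noteq> 0\<close> \<open>u - w \<noteq> 0\<close> by (metis inverse_inverse_eq inverse_mult_distrib
            mult.assoc mult.left_neutral of_real_eq_0_iff right_inverse)
      moreover from this have "y' \<noteq> ?p" using h0[OF y'(1)] \<open>u - w \<noteq> 0\<close> by auto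
      ultimately have "ext_val f y' = x" using y'(1) by (simp add: ext u)
      then show False using x y'(1) by auto
    qed
    ultimately show "\<exists>w'. x = Some w' \<and> Some ` closed_segment w w' \<subseteq> - ext_val f ` ball 0 1"
      by auto
  qed
  have "{z \<in> ball 0 1. is_pole f z} = {?p}" using pole not_pole p1 by auto
  then have "f \<in> Sigma_star p w"
    unfolding Sigma_star_def using nice inj_ext zo f0 df0 starlike by simp
  then show thesis using deriv_f by (rule that)
qed

text \<open>The extremal \<open>\<psi>\<close> is a disc automorphism applied to \<open>z \<mapsto> (b / (1 - |a|\<^sup>2)) z\<close>; when
  \<open>|a| = 1\<close> the division yields \<open>0\<close> and \<open>\<psi>\<close> is the constant \<open>a\<close>, as it must be.\<close>

lemma exists_Schwarz_Pick_extremal: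
  fixes a b :: complex
  assumes "norm b \<le> 1 - (norm a)\<^sup>2"
  obtains \<psi> where "\<psi> holomorphic_on ball 0 1" "\<And>z. norm z < 1 \<Longrightarrow> norm (\<psi> z) \<le> 1"
    "\<psi> 0 = a" "deriv \<psi> 0 = b"
proof (cases "norm a < 1")
  case True
  then have a2: "(norm a)\<^sup>2 < 1" by (simp add: abs_square_less_1)
  define t where "t = b / of_real (1 - (norm a)\<^sup>2)"
  have "norm t = norm b / \<bar>1 - (norm a)\<^sup>2\<bar>" by (simp only: t_def norm_divide norm_of_real)
  then have t: "norm t \<le> 1" using a2 assms by (simp add: divide_le_eq_1)
  have tz: "norm (t * z) < 1" if "norm z < 1" for z
    using mult_left_le[of "norm t" "norm z"] t that by (simp add: norm_mult mult.commute)
  define \<psi> where "\<psi> = (\<lambda>z. Moebius_function 0 (- a) (t * z))"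
  have na: "norm (- a) < 1" using True by simp
  have "(\<lambda>z. t * z) holomorphic_on ball 0 1" by (intro holomorphic_intros)
  then have "\<psi> holomorphic_on ball 0 1"
    unfolding \<psi>_def
    by (rule holomorphic_on_compose_gen[OF _ Moebius_function_holomorphic[OF na], unfolded o_def]) (use tz in auto)
  moreover have "norm (\<psi> z) \<le> 1" if "norm z < 1" for z
    unfolding \<psi>_def by (rule less_imp_le[OF Moebius_function_norm_lt_1[OF na tz[OF that]]])
  moreover have "\<psi> 0 = a" by (simp add: \<psi>_def Moebius_function_of_zero)
  moreover have "deriv \<psi> 0 = b"
  proof (rule DERIV_imp_deriv)
    have "1 - a * cnj a = of_real (1 - (norm a)\<^sup>2)"
      by (simp only: of_real_diff complex_norm_square of_real_1)
    moreover have "of_real (1 - (norm a)\<^sup>2) \<noteq> (0::complex)"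
      using a2 by (simp only: of_real_eq_0_iff)
    ultimately have "t * (1 - a * cnj a) = b" by (simp only: t_def) (metis nonzero_eq_divide_eq)
    then have "t - a * (cnj a * t) = b" by (simp add: algebra_simps)
    then show "(\<psi> has_field_derivative b) (at 0)"
      unfolding \<psi>_def Moebius_function_simple by (auto intro!: derivative_eq_intros)
  qed
  ultimately show thesis by (rule that)
next
  case False
  then have "1 \<le> (norm a)\<^sup>2" by (simp add: one_le_power)
  then have "norm b = 0" "(norm a)\<^sup>2 = 1" using assms norm_ge_zero[of b] by linarith+
  then have "b = 0" "norm a = 1" by (auto simp: power2_eq_1_iff) (use norm_ge_zero[of a] in linarith)
  then show thesis by (intro that[of "\<lambda>_. a"]) auto
qed

section \<open>The region of variability as a scaled Schwarz-Pick disc\<close>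

theorem theorem2p1:
  fixes p :: real and w\<^sub>0 :: complex
  assumes "0 < p" and "p < 1" and "w\<^sub>0 \<noteq> 0"
  shows "{taylor_coeff 2 f | f. f \<in> Sigma_star p w\<^sub>0} =
    {a :: complex.
       cmod (a - (of_real p + 1 / of_real p + w\<^sub>0)
               + 1 / 4 * w\<^sub>0 * (of_real p + 1 / of_real p + 1 / w\<^sub>0)\<^sup>2)
       \<le> cmod w\<^sub>0 * (1 - 1 / 4 * (cmod (of_real p + 1 / of_real p + 1 / w\<^sub>0))\<^sup>2)}"
proof -
  let ?p = "complex_of_real p"
  \<comment> \<open>This is twice the value \<open>\<psi> 0\<close> that the normalization
    \<open>deriv f 0 = 1\<close> forces.\<close>
  define s where "s = ?p + 1 / ?p + 1 / w\<^sub>0"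
  define centre where "centre = (?p + 1 / ?p + w\<^sub>0) - 1 / 4 * w\<^sub>0 * s\<^sup>2"
  have coeff: "deriv f 0 = w\<^sub>0 * (2 * \<psi> 0 - (?p + 1 / ?p))"
      "deriv f 0 = 1 \<Longrightarrow> taylor_coeff 2 f - centre = w\<^sub>0 * deriv \<psi> 0"
    if f: "f \<in> Sigma_star p w\<^sub>0" and \<psi>: "\<psi> holomorphic_on ball 0 1"
      and ode: "\<And>z. norm z < 1 \<Longrightarrow> z \<noteq> ?p \<Longrightarrow> deriv f z = (w\<^sub>0 - f z) *
         (2 * \<psi> z / (1 - z * \<psi> z) + 1 / (z - ?p) - ?p / (1 - ?p * z))" for f \<psi>
  proof -
    have 1: "f holomorphic_on ball 0 p" "\<psi> holomorphic_on ball 0 p"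
      by (rule holomorphic_on_subset[OF Sigma_star_D(1)[OF f]] holomorphic_on_subset[OF \<psi>];
          use assms in force)+
    have 2: "f 0 = 0" using f by (simp add: Sigma_star_def)
    have 3: "deriv f z = (w\<^sub>0 - f z) * (2 * \<psi> z / (1 - z * \<psi> z) + 1 / (z - ?p) - ?p / (1 - ?p * z))"
      if "norm z < p" for z
      by (rule ode) (use that assms in auto)
    have "?p \<noteq> 0" using assms by simp
    note T = taylor_coeff_2_parametrized[OF 1(1) assms(1) 2 _ 1(2) this]
    show "deriv f 0 = w\<^sub>0 * (2 * \<psi> 0 - (?p + 1 / ?p))"
      by (rule T(1)) (rule 3)
    assume "deriv f 0 = 1"
    then have "taylor_coeff 2 f - (?p + 1 / ?p + w\<^sub>0) + 1 / 4 * w\<^sub>0 * s\<^sup>2 = w\<^sub>0 * deriv \<psi> 0"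
      unfolding s_def by (intro T(2) 3)
    then show "taylor_coeff 2 f - centre = w\<^sub>0 * deriv \<psi> 0"
      by (simp add: centre_def algebra_simps)
  qed
  have s: "w\<^sub>0 * (2 * c - (?p + 1 / ?p)) = 1 \<longleftrightarrow> c = s / 2" for c
    using assms(3) by (auto simp: s_def field_simps)
  \<comment> \<open>The disc for the coefficient is the Schwarz-Pick disc for
    \<open>b = deriv \<psi> 0\<close>, scaled by \<open>w\<^sub>0\<close>. For
    \<open>cmod s > 2\<close> the radius is negative and both sets of the theorem are empty, without
    a separate case.\<close>
  have disc: "cmod (w\<^sub>0 * b) \<le> cmod w\<^sub>0 * (1 - 1 / 4 * (cmod s)\<^sup>2) \<longleftrightarrow> cmod b \<le> 1 - (cmod (s / 2))\<^sup>2" for b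
    using assms(3) by (simp add: norm_mult norm_divide power_divide)
  have "{taylor_coeff 2 f | f. f \<in> Sigma_star p w\<^sub>0} =
      {a. cmod (a - centre) \<le> cmod w\<^sub>0 * (1 - 1 / 4 * (cmod s)\<^sup>2)}"
  proof (intro equalityI subsetI; clarify)
    fix f assume f: "f \<in> Sigma_star p w\<^sub>0"
    obtain \<psi> where \<psi>: "\<psi> holomorphic_on ball 0 1" "\<And>z. norm z < 1 \<Longrightarrow> norm (\<psi> z) \<le> 1"
      "\<And>z. norm z < 1 \<Longrightarrow> z \<noteq> ?p \<Longrightarrow> deriv f z = (w\<^sub>0 - f z) *
         (2 * \<psi> z / (1 - z * \<psi> z) + 1 / (z - ?p) - ?p / (1 - ?p * z))"
      by (rule Sigma_star_parametrization[OF assms(1,2) f]) (rule that)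
    have df: "deriv f 0 = 1" using f by (simp add: Sigma_star_def)
    have "deriv f 0 = w\<^sub>0 * (2 * \<psi> 0 - (?p + 1 / ?p))"
      by (rule coeff(1)[OF f \<psi>(1)]) (rule \<psi>(3))
    then have "\<psi> 0 = s / 2" using df s by simp
    moreover have co: "taylor_coeff 2 f - centre = w\<^sub>0 * deriv \<psi> 0"
      by (rule coeff(2)[OF f \<psi>(1) _ df]) (rule \<psi>(3))
    ultimately show "cmod (taylor_coeff 2 f - centre) \<le> cmod w\<^sub>0 * (1 - 1 / 4 * (cmod s)\<^sup>2)"
      using Schwarz_Pick_at_0[OF \<psi>(1,2)] unfolding co disc by (simp only:)
  next
    fix a assume a: "cmod (a - centre) \<le> cmod w\<^sub>0 * (1 - 1 / 4 * (cmod s)\<^sup>2)"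
    define b where "b = (a - centre) / w\<^sub>0"
    have ab: "a - centre = w\<^sub>0 * b" using assms(3) by (simp add: b_def)
    then obtain \<psi> where \<psi>: "\<psi> holomorphic_on ball 0 1" "\<And>z. norm z < 1 \<Longrightarrow> norm (\<psi> z) \<le> 1"
      "\<psi> 0 = s / 2" "deriv \<psi> 0 = b"
      using exists_Schwarz_Pick_extremal a unfolding ab disc by metis
    obtain f where f: "f \<in> Sigma_star p w\<^sub>0"
      "\<And>z. norm z < 1 \<Longrightarrow> z \<noteq> ?p \<Longrightarrow> deriv f z = (w\<^sub>0 - f z) *
         (2 * \<psi> z / (1 - z * \<psi> z) + 1 / (z - ?p) - ?p / (1 - ?p * z))"
      by (rule Sigma_star_realization[OF assms \<psi>(1,2)]) (assumption, use s \<psi>(3) in blast, rule that)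
    have df: "deriv f 0 = 1" using f by (simp add: Sigma_star_def)
    have "taylor_coeff 2 f - centre = w\<^sub>0 * deriv \<psi> 0"
      by (rule coeff(2)[OF f(1) \<psi>(1) _ df]) (rule f(2))
    then have "taylor_coeff 2 f = a" using \<psi>(4) ab by (simp add: algebra_simps)
    then show "\<exists>f. a = taylor_coeff 2 f \<and> f \<in> Sigma_star p w\<^sub>0" using f(1) by auto
  qed
  also have "\<dots> = {a. cmod (a - (?p + 1 / ?p + w\<^sub>0) + 1 / 4 * w\<^sub>0 * s\<^sup>2)
      \<le> cmod w\<^sub>0 * (1 - 1 / 4 * (cmod s)\<^sup>2)}"
    by (simp add: centre_def algebra_simps)
  finally show ?thesis unfolding s_def .
qed

end
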